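(* Let $K$ be a field of characteristic zero and let $A$ be a commutative unital $K$-algebra which is a $\lambda$-ring with Adams operations $\psi^n$ ($n\ge 1$) satisfying $\psi^n|_K=\mathrm{id}$. Let $L_t:\bigoplus_{k\ge 0}A^{\otimes k}\to A[[t]]$ be the $K$-linear map with $L_t(1_K)=1$ and, for $k\ge 1$, $$L_t(a_1\otimes\dots\otimes a_k)=\sum_{n_1>\dots>n_k>0}t^{n_1}\prod_{i=1}^k\psi^{n_i}(a_i).$$ For $a\in A$ consider the continuous $A$-linear operators $$\mathcal P_a:tA[[t]]\to tA[[t]],\quad t^n\mapsto \psi^n(a)t^n,\qquad \mathcal T:A[[t]]\to tA[[t]],\quad f\mapsto \frac{t}{1-t}f.$$ Then for all $k\ge1$ and $a_1,\dots,a_k\in A$, $$L_t(a_1\otimes\dots\otimes a_k)=\mathcal P_{a_1}\mathcal T\cdots\mathcal P_{a_k}\mathcal T(1).$$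
   Context: Tensor products are over $K$, and $A^{\otimes 0}=K$. Since $A$ is a $\mathbb Q$-algebra, the $\lambda$-ring structure amounts to its Adams operations: ring endomorphisms $\psi^n:A\to A$ ($n\ge1$) with $\psi^1=\mathrm{id}$ and $\psi^m\psi^n=\psi^{mn}$. Sums over $n_1>\dots>n_k>0$ run over strictly decreasing tuples of positive integers. Continuity is with respect to the $t$-adic topology, so $\mathcal P_a(\sum_{n\ge1}c_nt^n)=\sum_{n\ge1}c_n\psi^n(a)t^n$. The right-hand side is the composition of operators applied to $1\in A[[t]]$. *)

theory Defs
  imports "HOL-Analysis.Analysis" "HOL-Library.Poly_Mapping"
    "HOL-Computational_Algebra.Formal_Power_Series"
begin

section \<open>Commutative algebras with Adams operations\<close>

text \<open>
  The field \<open>K\<close> acts on \<open>A\<close> through \<open>act\<close>; its image in \<open>A\<close> is the set of all \<open>act c 1\<close>.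
  As \<open>A\<close> contains the rationals, a \<open>\<lambda>\<close>-ring structure on it is the same thing as a family of
  Adams operations. The value of \<open>\<psi>\<close> at index \<open>0\<close> is irrelevant.
\<close>

locale lambda_algebra = vector_space act
  for act :: "'k::field_char_0 \<Rightarrow> 'a::comm_ring_1 \<Rightarrow> 'a" +
  fixes \<psi> :: "nat \<Rightarrow> 'a \<Rightarrow> 'a"
  assumes scale_mult_left: "act c a * b = act c (a * b)"
    and psi_add: "n \<ge> 1 \<Longrightarrow> \<psi> n (a + b) = \<psi> n a + \<psi> n b"
    and psi_mult: "n \<ge> 1 \<Longrightarrow> \<psi> n (a * b) = \<psi> n a * \<psi> n b"
    and psi_one: "n \<ge> 1 \<Longrightarrow> \<psi> n 1 = 1"
    and psi_id: "\<psi> 1 a = a"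
    and psi_psi: "m \<ge> 1 \<Longrightarrow> n \<ge> 1 \<Longrightarrow> \<psi> m (\<psi> n a) = \<psi> (m * n) a"
    and psi_scalar: "n \<ge> 1 \<Longrightarrow> \<psi> n (act c 1) = act c 1"


section \<open>The direct sum of all tensor powers\<close>

text \<open>
  The space \<open>\<Oplus>\<^sub>k A\<^sup>\<otimes>\<^sup>k\<close> is the free \<open>K\<close>-module on all finite words in \<open>A\<close>, modulo
  multilinearity in each letter. The relations only involve words of one common length, so the
  quotient is the direct sum over \<open>k\<close> of the usual constructions of \<open>A\<^sup>\<otimes>\<^sup>k\<close>. There is no relation in
  length \<open>0\<close>, and so the summand for \<open>k = 0\<close> is \<open>K\<close>, with the empty word as its \<open>1\<close>.
\<close>

definition free_scale :: "'k::field \<Rightarrow> ('w \<Rightarrow>\<^sub>0 'k) \<Rightarrow> ('w \<Rightarrow>\<^sub>0 'k)" where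
  "free_scale c x = Poly_Mapping.map ((*) c) x"

lemma lookup_free_scale [simp]:
  "Poly_Mapping.lookup (free_scale c x) w = c * Poly_Mapping.lookup x w"
  by (simp add: free_scale_def Poly_Mapping.map.rep_eq when_def)

lemma vector_space_free_scale: "vector_space free_scale"
  by unfold_locales (auto intro!: poly_mapping_eqI simp: lookup_add algebra_simps)

definition tensor_relators :: "('k::field \<Rightarrow> 'a::ab_group_add \<Rightarrow> 'a) \<Rightarrow> ('a list \<Rightarrow>\<^sub>0 'k) set" where
  "tensor_relators act =
     {Poly_Mapping.single (us @ (a + b) # vs) 1 - Poly_Mapping.single (us @ a # vs) 1
        - Poly_Mapping.single (us @ b # vs) 1 | us a b vs. True} \<union>
     {Poly_Mapping.single (us @ act c a # vs) 1
        - free_scale c (Poly_Mapping.single (us @ a # vs) 1) | us c a vs. True}"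

definition tensor_null :: "('k::field \<Rightarrow> 'a::ab_group_add \<Rightarrow> 'a) \<Rightarrow> ('a list \<Rightarrow>\<^sub>0 'k) set" where
  "tensor_null act = module.span free_scale (tensor_relators act)"

definition tensor_class ::
  "('k::field \<Rightarrow> 'a::ab_group_add \<Rightarrow> 'a) \<Rightarrow> ('a list \<Rightarrow>\<^sub>0 'k) \<Rightarrow> ('a list \<Rightarrow>\<^sub>0 'k) set" where
  "tensor_class act x = {y. y - x \<in> tensor_null act}"

definition pure_tensor ::
  "('k::field \<Rightarrow> 'a::ab_group_add \<Rightarrow> 'a) \<Rightarrow> 'a list \<Rightarrow> ('a list \<Rightarrow>\<^sub>0 'k) set" where
  "pure_tensor act as = tensor_class act (Poly_Mapping.single as 1)"


section \<open>The map \<open>L\<^sub>t\<close>\<close>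

definition decreasing_tuples :: "nat \<Rightarrow> nat list set" where
  "decreasing_tuples k = {ns. length ns = k \<and> sorted_wrt (>) ns \<and> (\<forall>n\<in>set ns. n > 0)}"

text \<open>The infinite sum is taken in the metric (that is, \<open>t\<close>-adic) topology of formal power series.\<close>

definition L_word :: "(nat \<Rightarrow> 'a \<Rightarrow> 'a::comm_ring_1) \<Rightarrow> 'a list \<Rightarrow> 'a fps" where
  "L_word \<psi> as = (if as = [] then 1 else
     (\<Sum>\<^sub>\<infinity>ns\<in>decreasing_tuples (length as).
        fps_X ^ hd ns * fps_const (\<Prod>i<length as. \<psi> (ns ! i) (as ! i))))"

definition L_free ::
  "('k::field \<Rightarrow> 'a \<Rightarrow> 'a::comm_ring_1) \<Rightarrow> (nat \<Rightarrow> 'a \<Rightarrow> 'a) \<Rightarrow> ('a list \<Rightarrow>\<^sub>0 'k) \<Rightarrow> 'a fps" where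
  "L_free act \<psi> x =
     (\<Sum>as\<in>Poly_Mapping.keys x. fps_const (act (Poly_Mapping.lookup x as) 1) * L_word \<psi> as)"

text \<open>\<open>L_free\<close> is \<open>K\<close>-linear and constant on classes (see \<open>L_t_tensor_class\<close> below), so \<open>L_t\<close> is the \<open>K\<close>-linear map
  that it induces on the quotient.\<close>

definition L_t ::
  "('k::field \<Rightarrow> 'a \<Rightarrow> 'a::comm_ring_1) \<Rightarrow> (nat \<Rightarrow> 'a \<Rightarrow> 'a) \<Rightarrow> ('a list \<Rightarrow>\<^sub>0 'k) set \<Rightarrow> 'a fps" where
  "L_t act \<psi> u = the_elem (L_free act \<psi> ` u)"

lemma finite_decreasing_tuples: "finite {ns \<in> decreasing_tuples k. hd ns = m}"
proof (rule finite_subset)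
  show "{ns \<in> decreasing_tuples k. hd ns = m} \<subseteq> {ns. set ns \<subseteq> {..m} \<and> length ns = k}"
  proof
    fix ns
    assume "ns \<in> {ns \<in> decreasing_tuples k. hd ns = m}"
    then show "ns \<in> {ns. set ns \<subseteq> {..m} \<and> length ns = k}"
      by (cases ns) (auto simp: decreasing_tuples_def)
  qed
qed (simp add: finite_lists_length_eq)

lemma has_sum_L_word:
  assumes "as \<noteq> []"
  shows "((\<lambda>ns. fps_X ^ hd ns * fps_const (\<Prod>i<length as. \<psi> (ns ! i) (as ! i)))
           has_sum L_word \<psi> as) (decreasing_tuples (length as))"
    and "fps_nth (L_word \<psi> as) m =
           (\<Sum>ns | ns \<in> decreasing_tuples (length as) \<and> hd ns = m.
              \<Prod>i<length as. \<psi> (ns ! i) (as ! i))"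
proof -
  define F where "F = (\<lambda>ns. \<Prod>i<length as. \<psi> (ns ! i) (as ! i))"
  define D where "D = decreasing_tuples (length as)"
  have fin: "finite {ns \<in> D. hd ns = m}" for m
    unfolding D_def by (rule finite_decreasing_tuples)
  define S where "S = Abs_fps (\<lambda>m. \<Sum>ns | ns \<in> D \<and> hd ns = m. F ns)"
  have nth: "fps_nth (fps_X ^ hd ns * fps_const (F ns)) n = (if n = hd ns then F ns else 0)"
    for ns n
    by simp
  have sum: "((\<lambda>ns. fps_X ^ hd ns * fps_const (F ns)) has_sum S) D"
  proof (rule has_sum_fpsI)
    fix n
    show "finite {ns \<in> D. fps_nth (fps_X ^ hd ns * fps_const (F ns)) n \<noteq> 0}"
      by (rule finite_subset[OF _ fin[of n]]) (auto simp: nth split: if_splits)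
    show "fps_nth S n = (\<Sum>ns | ns \<in> D \<and> fps_nth (fps_X ^ hd ns * fps_const (F ns)) n \<noteq> 0.
                           fps_nth (fps_X ^ hd ns * fps_const (F ns)) n)"
      unfolding S_def fps_nth_Abs_fps
      by (rule sum.mono_neutral_cong_right[OF fin]) (auto simp: nth split: if_splits)
  qed
  have eq: "L_word \<psi> as = S"
    using assms infsumI[OF sum] by (simp add: L_word_def F_def D_def)
  show "((\<lambda>ns. fps_X ^ hd ns * fps_const (\<Prod>i<length as. \<psi> (ns ! i) (as ! i)))
           has_sum L_word \<psi> as) (decreasing_tuples (length as))"
    using sum unfolding eq F_def D_def .
  show "fps_nth (L_word \<psi> as) m =
           (\<Sum>ns | ns \<in> decreasing_tuples (length as) \<and> hd ns = m.
              \<Prod>i<length as. \<psi> (ns ! i) (as ! i))"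
    unfolding eq S_def fps_nth_Abs_fps F_def D_def ..
qed

lemma prod_nth_append_Cons:
  fixes g :: "nat \<Rightarrow> 'a \<Rightarrow> 'b::comm_monoid_mult"
  shows "(\<Prod>i<length (us @ a # vs). g i ((us @ a # vs) ! i)) =
     g (length us) a *
       (\<Prod>i\<in>{..<Suc (length us + length vs)} - {length us}. g i ((us @ undefined # vs) ! i))"
proof -
  have "(\<Prod>i<length (us @ a # vs). g i ((us @ a # vs) ! i)) =
          g (length us) ((us @ a # vs) ! length us) *
          (\<Prod>i\<in>{..<Suc (length us + length vs)} - {length us}. g i ((us @ a # vs) ! i))"
    by (subst prod.remove[where x = "length us"]) auto
  also have "(\<Prod>i\<in>{..<Suc (length us + length vs)} - {length us}. g i ((us @ a # vs) ! i)) =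
      (\<Prod>i\<in>{..<Suc (length us + length vs)} - {length us}. g i ((us @ undefined # vs) ! i))"
    by (rule prod.cong) (auto simp: nth_append nth_Cons split: nat.splits)
  finally show ?thesis by simp
qed

context lambda_algebra
begin

lemma scale_conv_mult: "act c a = act c 1 * a"
  by (simp add: scale_mult_left)

lemma psi_scale: "n \<ge> 1 \<Longrightarrow> \<psi> n (act c a) = act c 1 * \<psi> n a"
  by (subst scale_conv_mult) (simp add: psi_mult psi_scalar)

lemma decreasing_tuples_pos:
  "ns \<in> decreasing_tuples k \<Longrightarrow> i < k \<Longrightarrow> ns ! i \<ge> 1"
  by (auto simp: decreasing_tuples_def Suc_le_eq)

lemma L_word_add:
  "L_word \<psi> (us @ (a + b) # vs) = L_word \<psi> (us @ a # vs) + L_word \<psi> (us @ b # vs)"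
proof (rule fps_ext)
  fix m
  let ?C = "\<lambda>ns. \<Prod>i\<in>{..<Suc (length us + length vs)} - {length us}.
              \<psi> (ns ! i) ((us @ undefined # vs) ! i)"
  have nth: "fps_nth (L_word \<psi> (us @ x # vs)) m =
      (\<Sum>ns | ns \<in> decreasing_tuples (Suc (length us + length vs)) \<and> hd ns = m.
         \<psi> (ns ! length us) x * ?C ns)" for x
    by (subst has_sum_L_word(2), simp, subst prod_nth_append_Cons) simp
  have pos: "ns ! length us \<ge> 1" if "ns \<in> decreasing_tuples (Suc (length us + length vs))" for ns
    using decreasing_tuples_pos[OF that, of "length us"] by simp
  show "fps_nth (L_word \<psi> (us @ (a + b) # vs)) m =
          fps_nth (L_word \<psi> (us @ a # vs) + L_word \<psi> (us @ b # vs)) m"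
    unfolding fps_add_nth nth sum.distrib[symmetric]
    by (rule sum.cong) (simp_all add: psi_add[OF pos] distrib_right)
qed

lemma L_word_scale:
  "L_word \<psi> (us @ act c a # vs) = fps_const (act c 1) * L_word \<psi> (us @ a # vs)"
proof (rule fps_ext)
  fix m
  let ?C = "\<lambda>ns. \<Prod>i\<in>{..<Suc (length us + length vs)} - {length us}.
              \<psi> (ns ! i) ((us @ undefined # vs) ! i)"
  have nth: "fps_nth (L_word \<psi> (us @ x # vs)) m =
      (\<Sum>ns | ns \<in> decreasing_tuples (Suc (length us + length vs)) \<and> hd ns = m.
         \<psi> (ns ! length us) x * ?C ns)" for x
    by (subst has_sum_L_word(2), simp, subst prod_nth_append_Cons) simp
  have pos: "ns ! length us \<ge> 1" if "ns \<in> decreasing_tuples (Suc (length us + length vs))" for ns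
    using decreasing_tuples_pos[OF that, of "length us"] by simp
  show "fps_nth (L_word \<psi> (us @ act c a # vs)) m =
          fps_nth (fps_const (act c 1) * L_word \<psi> (us @ a # vs)) m"
    unfolding fps_mult_left_const_nth nth sum_distrib_left
    by (rule sum.cong) (simp_all add: psi_scale[OF pos] mult.assoc)
qed

lemma L_free_superset:
  assumes "finite W" "Poly_Mapping.keys x \<subseteq> W"
  shows "L_free act \<psi> x =
           (\<Sum>w\<in>W. fps_const (act (Poly_Mapping.lookup x w) 1) * L_word \<psi> w)"
  unfolding L_free_def
  by (rule sum.mono_neutral_left) (use assms in \<open>auto simp: in_keys_iff\<close>)

lemma L_free_add: "L_free act \<psi> (x + y) = L_free act \<psi> x + L_free act \<psi> y"
proof -
  define W where "W = Poly_Mapping.keys x \<union> Poly_Mapping.keys y"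
  have W: "finite W" "Poly_Mapping.keys x \<subseteq> W" "Poly_Mapping.keys y \<subseteq> W"
      "Poly_Mapping.keys (x + y) \<subseteq> W"
    using Poly_Mapping.keys_add[of x y] by (auto simp: W_def)
  show ?thesis
    by (simp add: W L_free_superset[of W] lookup_add scale_left_distrib algebra_simps
        sum.distrib flip: fps_const_add)
qed

lemma L_free_scale:
  "L_free act \<psi> (free_scale c x) = fps_const (act c 1) * L_free act \<psi> x"
proof -
  have W: "finite (Poly_Mapping.keys x)" "Poly_Mapping.keys (free_scale c x) \<subseteq> Poly_Mapping.keys x"
    by (auto simp: in_keys_iff)
  have "act (c * d) 1 = act c 1 * act d 1" for d
    by (simp add: scale_mult_left)
  then show ?thesis
    by (simp add: W L_free_superset[of "Poly_Mapping.keys x"] sum_distrib_left mult.assoc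
        flip: fps_const_mult)
qed

lemma L_free_diff: "L_free act \<psi> (x - y) = L_free act \<psi> x - L_free act \<psi> y"
  using L_free_add[of "x - y" y] by simp

lemma L_free_single: "L_free act \<psi> (Poly_Mapping.single as 1) = L_word \<psi> as"
  by (simp add: L_free_def)

lemma L_free_tensor_null:
  assumes "x \<in> tensor_null act"
  shows "L_free act \<psi> x = 0"
proof -
  interpret free: vector_space "free_scale :: 'k \<Rightarrow> ('a list \<Rightarrow>\<^sub>0 'k) \<Rightarrow> _"
    by (rule vector_space_free_scale)
  show ?thesis
    using assms unfolding tensor_null_def
  proof (induction rule: free.span_induct_alt)
    case base
    show ?case by (simp add: L_free_def)
  next
    case (step c r y)
    from step(1) have "L_free act \<psi> r = 0"
      unfolding tensor_relators_def
    proof (elim UnE CollectE exE conjE)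
      fix us a b vs
      assume "r = Poly_Mapping.single (us @ (a + b) # vs) 1 - Poly_Mapping.single (us @ a # vs) 1
                - Poly_Mapping.single (us @ b # vs) 1"
      then show ?thesis by (simp only: L_free_diff L_free_single L_word_add) simp
    next
      fix us c a vs
      assume "r = Poly_Mapping.single (us @ act c a # vs) 1
                - free_scale c (Poly_Mapping.single (us @ a # vs) 1)"
      then show ?thesis
        by (simp only: L_free_diff L_free_scale L_free_single L_word_scale[of us c a vs]) simp
    qed
    with step(2) show ?case by (simp only: L_free_add L_free_scale) simp
  qed
qed

lemma L_t_tensor_class: "L_t act \<psi> (tensor_class act x) = L_free act \<psi> x"
proof -
  interpret free: vector_space "free_scale :: 'k \<Rightarrow> ('a list \<Rightarrow>\<^sub>0 'k) \<Rightarrow> _"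
    by (rule vector_space_free_scale)
  have "x \<in> tensor_class act x"
    by (simp add: tensor_class_def tensor_null_def free.span_zero)
  moreover have "L_free act \<psi> y = L_free act \<psi> x" if "y \<in> tensor_class act x" for y
  proof -
    have "L_free act \<psi> (y - x) = 0"
      using that by (intro L_free_tensor_null) (simp add: tensor_class_def)
    then show ?thesis by (simp only: L_free_diff) simp
  qed
  ultimately have "L_free act \<psi> ` tensor_class act x = {L_free act \<psi> x}"
    by blast
  then show ?thesis by (simp add: L_t_def)
qed

lemma L_t_pure_tensor: "L_t act \<psi> (pure_tensor act as) = L_word \<psi> as"
  by (simp add: pure_tensor_def L_t_tensor_class L_free_single)

end


section \<open>The operators\<close>

text \<open>Only the values of \<open>P_op\<close> on \<open>tA[[t]]\<close> are meaningful. Since \<open>A\<close> need not carry an inverse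
  operation, \<open>1/(1-t)\<close> is written with the one-sided inverse of power series over rings.\<close>

definition P_op :: "(nat \<Rightarrow> 'a \<Rightarrow> 'a::comm_ring_1) \<Rightarrow> 'a \<Rightarrow> 'a fps \<Rightarrow> 'a fps" where
  "P_op \<psi> a f = Abs_fps (\<lambda>n. if n = 0 then 0 else fps_nth f n * \<psi> n a)"

definition T_op :: "'a::comm_ring_1 fps \<Rightarrow> 'a fps" where
  "T_op f = fps_X * fps_right_inverse (1 - fps_X) 1 * f"

lemma P_op_fps_X_power: "n \<ge> 1 \<Longrightarrow> P_op \<psi> a (fps_X ^ n) = fps_const (\<psi> n a) * fps_X ^ n"
  by (rule fps_ext) (simp add: P_op_def)

lemma P_op_add: "P_op \<psi> a (f + g) = P_op \<psi> a f + P_op \<psi> a g"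
  by (rule fps_ext) (simp add: P_op_def algebra_simps)

lemma P_op_scale: "P_op \<psi> a (fps_const c * f) = fps_const c * P_op \<psi> a f"
  by (rule fps_ext) (simp add: P_op_def algebra_simps)

lemma continuous_P_op: "continuous_on UNIV (P_op \<psi> a)"
  unfolding continuous_on_def
proof (intro ballI tendsto_fpsI)
  fix f :: "'a fps" and n
  have "((\<lambda>g. g) \<longlongrightarrow> f) (at f within UNIV)"
    by (rule tendsto_ident_at)
  then have "\<forall>\<^sub>F g in at f within UNIV. fps_nth g n = fps_nth f n"
    unfolding tendsto_fps_iff by blast
  then show "\<forall>\<^sub>F g in at f within UNIV. fps_nth (P_op \<psi> a g) n = fps_nth (P_op \<psi> a f) n"
    by eventually_elim (simp add: P_op_def)
qed

lemma T_op_nth_0: "fps_nth (T_op f) 0 = 0"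
  by (simp add: T_op_def)

lemma T_op_eq: "(1 - fps_X) * T_op f = fps_X * f"
proof -
  have "(1 - fps_X) * fps_right_inverse (1 - fps_X) 1 = (1 :: 'a fps)"
    by (rule fps_right_inverse) simp
  then have "fps_X * ((1 - fps_X) * fps_right_inverse (1 - fps_X) 1) * f = fps_X * f"
    by simp
  then show ?thesis by (simp only: T_op_def mult_ac)
qed

end

(* Stripping the largest index n_1 from a decreasing tuple gives a recursion for the coefficients
   of L_t in the number of letters; it matches the operators because T takes partial sums of
   coefficients and P_a weights the n-th one by psi^n(a). *)
theory Submission
  imports Defs
begin

text \<open>Comparing coefficients of \<open>t^(n+1)\<close> in \<open>T_op_eq\<close> gives a
  one-step recurrence, so the series of \<open>1/(1-t)\<close> is never expanded.\<close>

lemma T_op_nth: "fps_nth (T_op f) n = (\<Sum>m<n. fps_nth f m)"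
proof (induction n)
  case 0
  show ?case by (simp add: T_op_nth_0)
next
  case (Suc n)
  have "fps_nth ((1 - fps_X) * T_op f) (Suc n) = fps_nth (fps_X * f) (Suc n)"
    by (simp only: T_op_eq)
  then have "fps_nth (T_op f) (Suc n) = fps_nth (T_op f) n + fps_nth f n"
    by (simp add: left_diff_distrib algebra_simps)
  with Suc show ?case by simp
qed

lemma decreasing_tuples_0: "decreasing_tuples 0 = {[]}"
  by (auto simp: decreasing_tuples_def)

lemma decreasing_tuples_hd_0: "{ns \<in> decreasing_tuples (Suc k). hd ns = 0} = {}"
  by (auto simp: decreasing_tuples_def length_Suc_conv)

text \<open>Length one is separate from the recursion below: its tail is empty, and
  \<open>hd []\<close> is unspecified.\<close>

lemma decreasing_tuples_hd_Suc_0: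
  "n > 0 \<Longrightarrow> {ns \<in> decreasing_tuples (Suc 0). hd ns = n} = {[n]}"
  by (auto simp: decreasing_tuples_def length_Suc_conv)

text \<open>The tail is nonempty and decreasing, so \<open>n\<close> exceeds all its entries as soon
  as it exceeds the first one, \<open>m\<close>. Grouping by \<open>m\<close> matches the
  coefficients of the shorter word.\<close>

lemma decreasing_tuples_hd_Suc_Suc:
  "{ns \<in> decreasing_tuples (Suc (Suc k)). hd ns = n} =
     Cons n ` (\<Union>m<n. {ns \<in> decreasing_tuples (Suc k). hd ns = m})"
proof (intro set_eqI iffI)
  fix ns assume "ns \<in> {ns \<in> decreasing_tuples (Suc (Suc k)). hd ns = n}"
  then show "ns \<in> Cons n ` (\<Union>m<n. {ns \<in> decreasing_tuples (Suc k). hd ns = m})"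
    by (cases ns; cases "tl ns") (auto simp: decreasing_tuples_def)
next
  fix ns assume "ns \<in> Cons n ` (\<Union>m<n. {ns \<in> decreasing_tuples (Suc k). hd ns = m})"
  then obtain ms where "ns = n # ms" "ms \<in> decreasing_tuples (Suc k)" "hd ms < n"
    by auto
  then show "ns \<in> {ns \<in> decreasing_tuples (Suc (Suc k)). hd ns = n}"
    by (cases ms) (auto simp: decreasing_tuples_def)
qed

lemma L_word_Cons_nth:
  "fps_nth (L_word \<psi> (a # as)) n =
     (if n = 0 then 0 else \<psi> n a * (\<Sum>m<n. fps_nth (L_word \<psi> as) m))"
proof (cases "n = 0")
  case True
  then show ?thesis
    by (simp add: has_sum_L_word(2) decreasing_tuples_hd_0)
next
  case n: False
  show ?thesis
  proof (cases as)
    case Nil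
    \<comment> \<open>The constant term 1 of the empty word stands for the empty tail; it lies in
      the range \<open>m < n\<close> because \<open>n > 0\<close>.\<close>
    have "L_word \<psi> [] = 1"
      by (simp add: L_word_def)
    then have "(\<Sum>m<n. fps_nth (L_word \<psi> []) m) = 1"
      using n by simp
    with Nil n show ?thesis
      by (simp add: has_sum_L_word(2) decreasing_tuples_hd_Suc_0)
  next
    case (Cons b bs)
    let ?D = "\<lambda>m. {ns \<in> decreasing_tuples (Suc (length bs)). hd ns = m}"
    let ?F = "\<lambda>ns. \<Prod>i<length as. \<psi> (ns ! i) (as ! i)"
    have F_Cons: "(\<Prod>i<length (a # as). \<psi> ((n # ns) ! i) ((a # as) ! i)) = \<psi> n a * ?F ns" for ns
      by (simp add: prod.lessThan_Suc_shift del: prod.lessThan_Suc)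
    have "fps_nth (L_word \<psi> (a # as)) n = (\<Sum>ns\<in>Cons n ` (\<Union>m<n. ?D m).
            \<Prod>i<length (a # as). \<psi> (ns ! i) ((a # as) ! i))"
      using Cons by (subst has_sum_L_word(2)) (simp_all only: list.size(4) add_0_right
          add_Suc_right One_nat_def decreasing_tuples_hd_Suc_Suc list.distinct not_False_eq_True)
    also have "\<dots> = (\<Sum>ns\<in>(\<Union>m<n. ?D m). \<psi> n a * ?F ns)"
      by (subst sum.reindex) (simp_all only: o_def F_Cons inj_on_def list.inject, simp)
    also have "\<dots> = (\<Sum>m<n. \<Sum>ns\<in>?D m. \<psi> n a * ?F ns)"
      \<comment> \<open>The head of a tuple determines \<open>m\<close>, so the pieces are
        disjoint.\<close>
      by (rule sum.UNION_disjoint) (auto intro: finite_decreasing_tuples)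
    also have "\<dots> = \<psi> n a * (\<Sum>m<n. fps_nth (L_word \<psi> as) m)"
      using Cons by (simp add: has_sum_L_word(2) sum_distrib_left)
    finally show ?thesis using n by simp
  qed
qed

lemma L_word_Cons: "L_word \<psi> (a # as) = P_op \<psi> a (T_op (L_word \<psi> as))"
  by (rule fps_ext) (simp add: L_word_Cons_nth P_op_def T_op_nth mult.commute)

text \<open>\<open>foldr\<close> puts the operator of the first letter outermost, just as the first
  letter carries the largest index; hence induction from the head.\<close>

lemma L_word_conv_foldr: "L_word \<psi> as = foldr (\<lambda>a. P_op \<psi> a \<circ> T_op) as 1"
proof (induction as)
  case Nil
  show ?case by (simp add: L_word_def)
next
  case (Cons a as)
  then show ?case by (simp add: L_word_Cons)
qed

theorem theorem1:
  fixes act :: "'k::field_char_0 \<Rightarrow> 'a::comm_ring_1 \<Rightarrow> 'a"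
    and \<psi> :: "nat \<Rightarrow> 'a \<Rightarrow> 'a"
    and as :: "'a list"
  assumes "lambda_algebra act \<psi>"
    and "length as \<ge> 1"
  shows "L_t act \<psi> (pure_tensor act as) = foldr (\<lambda>a. P_op \<psi> a \<circ> T_op) as 1"
  \<comment> \<open>\<open>K\<close>-linearity of the Adams operations makes \<open>L_t\<close> well
    defined on tensor classes, which reduces the claim to words.\<close>
  using lambda_algebra.L_t_pure_tensor[OF assms(1)] L_word_conv_foldr by metis

end
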